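(* Let $\mathcal{Q}$ be a small quantaloid and let $(F,G):(\phi:\mathbb{A}\nrightarrow\mathbb{B})\to(\psi:\mathbb{A}'\nrightarrow\mathbb{B}')$ be an infomorphism between $\mathcal{Q}$-distributors. Then $G:(\mathbb{B}',\psi_*\circ\psi^* )\to(\mathbb{B},\phi_*\circ\phi^* )$ is a continuous $\mathcal{Q}$-functor between $\mathcal{Q}$-closure spaces.
   Context: A small quantaloid $\mathcal{Q}$ is a category with a set $\mathcal{Q}_0$ of objects, each hom-set $\mathcal{Q}(A,B)$ a complete lattice, and composition $\circ$ preserving arbitrary joins in each variable. For $f\in\mathcal{Q}(A,B)$ and $g\in\mathcal{Q}(A,X)$, $g\swarrow f\in\mathcal{Q}(B,X)$ is the largest $h$ with $h\circ f\le g$. A $\mathcal{Q}$-category $\mathbb{A}$ is a set $\mathbb{A}_0$ with a type map $t:\mathbb{A}_0\to\mathcal{Q}_0$ and hom-arrows $\mathbb{A}(x,y)\in\mathcal{Q}(tx,ty)$ such that $1_{tx}\le\mathbb{A}(x,x)$ and $\mathbb{A}(y,z)\circ\mathbb{A}(x,y)\le\mathbb{A}(x,z)$. A $\mathcal{Q}$-functor $F:\mathbb{A}\to\mathbb{B}$ is a type-preserving map $\mathbb{A}_0\to\mathbb{B}_0$ with $\mathbb{A}(x,x')\le\mathbb{B}(Fx,Fx')$. Underlying preorder: $x\le y$ iff $tx=ty$ and $1_{tx}\le\mathbb{A}(x,y)$; $x\cong y$ iff $x\le y$ and $y\le x$; $\mathcal{Q}$-functors are preordered pointwise (and $\cong$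 is pointwise). A $\mathcal{Q}$-distributor $\phi:\mathbb{A}\nrightarrow\mathbb{B}$ is a family $\phi(x,y)\in\mathcal{Q}(tx,ty)$ ($x\in\mathbb{A}_0,y\in\mathbb{B}_0$) with $\mathbb{B}(y',y)\circ\phi(x,y')\le\phi(x,y)$ and $\phi(x',y)\circ\mathbb{A}(x,x')\le\phi(x,y)$. For $\phi:\mathbb{A}\nrightarrow\mathbb{B}$, $\psi:\mathbb{B}\nrightarrow\mathbb{C}$, $\eta:\mathbb{A}\nrightarrow\mathbb{C}$: $(\psi\circ\phi)(x,z)=\bigvee_y\psi(y,z)\circ\phi(x,y)$; $\eta\swarrow\phi:\mathbb{B}\nrightarrow\mathbb{C}$ is $(\eta\swarrow\phi)(y,z)=\bigwedge_x\eta(x,z)\swarrow\phi(x,y)$. The graph and cograph of $F:\mathbb{A}\to\mathbb{B}$ are $F_{\natural}:\mathbb{A}\nrightarrow\mathbb{B}$, $F_{\natural}(x,y)=\mathbb{B}(Fx,y)$ and $F^{\natural}:\mathbb{B}\nrightarrow\mathbb{A}$, $F^{\natural}(y,x)=\mathbb{B}(y,Fx)$. For $X\in\mathcal{Q}_0$, $*_X$ is the $\mathcal{Q}$-category with one object of type $X$ and hom-arrow $1_X$. $\mathcal{P}\mathbb{A}$ has as objects of type $X$ the distributors $\mu:\mathbb{A}\nrightarrow *_X$, with $\mathcal{P}\mathbb{A}(\mu,\lambda)=\lambda\swarrow\mu$. For a $\mathcal{Q}$-functor $F:\mathbb{A}\to\mathbb{B}$, $F^{\rightarrow}:\mathcal{P}\mathbb{A}\to\mathcal{P}\mathbb{B}$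 is $F^{\rightarrow}(\mu)=\mu\circ F^{\natural}$. For a distributor $\phi:\mathbb{A}\nrightarrow\mathbb{B}$: $\phi^*:\mathcal{P}\mathbb{B}\to\mathcal{P}\mathbb{A}$, $\phi^*(\lambda)=\lambda\circ\phi$, and $\phi_*:\mathcal{P}\mathbb{A}\to\mathcal{P}\mathbb{B}$, $\phi_*(\mu)=\mu\swarrow\phi$; $\phi_*\circ\phi^*$ is a $\mathcal{Q}$-closure operator on $\mathcal{P}\mathbb{B}$. An infomorphism $(F,G):(\phi:\mathbb{A}\nrightarrow\mathbb{B})\to(\psi:\mathbb{A}'\nrightarrow\mathbb{B}')$ is a pair of $\mathcal{Q}$-functors $F:\mathbb{A}\to\mathbb{A}'$, $G:\mathbb{B}'\to\mathbb{B}$ with $G^{\natural}\circ\phi=\psi\circ F_{\natural}$, equivalently $\phi(x,Gy')=\psi(Fx,y')$ for all $x\in\mathbb{A}_0,y'\in\mathbb{B}'_0$. A $\mathcal{Q}$-closure operator on a $\mathcal{Q}$-category $\mathbb{C}$ is a $\mathcal{Q}$-functor $C:\mathbb{C}\to\mathbb{C}$ with $1_{\mathbb{C}}\le C$ and $C^2\cong C$. A $\mathcal{Q}$-closure space is a pair $(\mathbb{A},C)$ with $\mathbb{A}$ a $\mathcal{Q}$-category and $C$ a $\mathcal{Q}$-closure operator on $\mathcal{P}\mathbb{A}$. A continuous $\mathcal{Q}$-functor $F:(\mathbb{A},C)\to(\mathbb{B},D)$ is a $\mathcal{Q}$-functor $F:\mathbb{A}\to\mathbb{B}$ with $F^{\rightarrow}\circ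 C\le D\circ F^{\rightarrow}$. *)

theory Defs
  imports "HOL-Algebra.Complete_Lattice"
begin

section \<open>Quantaloids\<close>

text \<open>The hom-sets need not be disjoint, so composition carries its three objects:
  \<open>qcomp Q A B C g f\<close> is \<open>g \<circ> f\<close> for \<open>f \<in> Q(A,B)\<close> and \<open>g \<in> Q(B,C)\<close>. The field \<open>eq\<close> of
  \<^typ>\<open>'m gorder\<close> is forced to be equality by \<^const>\<open>complete_lattice\<close>; joins include the
  empty one, since \<^const>\<open>sup_pres\<close> does not require nonempty sets.\<close>

record ('o, 'm) quantaloid =
  qob :: "'o set"
  qhom :: "'o \<Rightarrow> 'o \<Rightarrow> 'm gorder"
  qcomp :: "'o \<Rightarrow> 'o \<Rightarrow> 'o \<Rightarrow> 'm \<Rightarrow> 'm \<Rightarrow> 'm"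
  qid :: "'o \<Rightarrow> 'm"

locale quantaloid =
  fixes Q :: "('o, 'm) quantaloid"
  assumes hom_complete_lattice:
      "\<lbrakk>A \<in> qob Q; B \<in> qob Q\<rbrakk> \<Longrightarrow> complete_lattice (qhom Q A B)"
    and comp_closed:
      "\<lbrakk>A \<in> qob Q; B \<in> qob Q; C \<in> qob Q; f \<in> carrier (qhom Q A B); g \<in> carrier (qhom Q B C)\<rbrakk>
        \<Longrightarrow> qcomp Q A B C g f \<in> carrier (qhom Q A C)"
    and id_closed:
      "A \<in> qob Q \<Longrightarrow> qid Q A \<in> carrier (qhom Q A A)"
    and comp_assoc:
      "\<lbrakk>A \<in> qob Q; B \<in> qob Q; C \<in> qob Q; D \<in> qob Q;
        f \<in> carrier (qhom Q A B); g \<in> carrier (qhom Q B C); h \<in> carrier (qhom Q C D)\<rbrakk>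
        \<Longrightarrow> qcomp Q A C D h (qcomp Q A B C g f) = qcomp Q A B D (qcomp Q B C D h g) f"
    and id_left:
      "\<lbrakk>A \<in> qob Q; B \<in> qob Q; f \<in> carrier (qhom Q A B)\<rbrakk> \<Longrightarrow> qcomp Q A B B (qid Q B) f = f"
    and id_right:
      "\<lbrakk>A \<in> qob Q; B \<in> qob Q; f \<in> carrier (qhom Q A B)\<rbrakk> \<Longrightarrow> qcomp Q A A B f (qid Q A) = f"
    and comp_sup_right:
      "\<lbrakk>A \<in> qob Q; B \<in> qob Q; C \<in> qob Q; g \<in> carrier (qhom Q B C)\<rbrakk>
        \<Longrightarrow> sup_pres (qhom Q A B) (qhom Q A C) (\<lambda>f. qcomp Q A B C g f)"
    and comp_sup_left:
      "\<lbrakk>A \<in> qob Q; B \<in> qob Q; C \<in> qob Q; f \<in> carrier (qhom Q A B)\<rbrakk>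
        \<Longrightarrow> sup_pres (qhom Q B C) (qhom Q A C) (\<lambda>g. qcomp Q A B C g f)"

text \<open>\<open>qimp Q A B X g f\<close> is \<open>g \<swarrow> f \<in> Q(B,X)\<close> for \<open>f \<in> Q(A,B)\<close> and \<open>g \<in> Q(A,X)\<close>.\<close>

definition qimp :: "('o, 'm) quantaloid \<Rightarrow> 'o \<Rightarrow> 'o \<Rightarrow> 'o \<Rightarrow> 'm \<Rightarrow> 'm \<Rightarrow> 'm" where
  "qimp Q A B X g f =
    (THE h. greatest (qhom Q B X) h
      {h \<in> carrier (qhom Q B X). qcomp Q A B X h f \<sqsubseteq>\<^bsub>qhom Q A X\<^esub> g})"

section \<open>Categories and functors over a quantaloid\<close>

record ('a, 'o, 'm) qcat = "'a partial_object" +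
  ctype :: "'a \<Rightarrow> 'o"
  chom :: "'a \<Rightarrow> 'a \<Rightarrow> 'm"

definition qcategory :: "('o, 'm) quantaloid \<Rightarrow> ('a, 'o, 'm) qcat \<Rightarrow> bool" where
  "qcategory Q \<A> \<longleftrightarrow>
    (\<forall>x\<in>carrier \<A>. ctype \<A> x \<in> qob Q) \<and>
    (\<forall>x\<in>carrier \<A>. \<forall>y\<in>carrier \<A>. chom \<A> x y \<in> carrier (qhom Q (ctype \<A> x) (ctype \<A> y))) \<and>
    (\<forall>x\<in>carrier \<A>. qid Q (ctype \<A> x) \<sqsubseteq>\<^bsub>qhom Q (ctype \<A> x) (ctype \<A> x)\<^esub> chom \<A> x x) \<and>
    (\<forall>x\<in>carrier \<A>. \<forall>y\<in>carrier \<A>. \<forall>z\<in>carrier \<A>.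
      qcomp Q (ctype \<A> x) (ctype \<A> y) (ctype \<A> z) (chom \<A> y z) (chom \<A> x y)
        \<sqsubseteq>\<^bsub>qhom Q (ctype \<A> x) (ctype \<A> z)\<^esub> chom \<A> x z)"

text \<open>The values of a functor outside the carrier of its domain are irrelevant; functors are
  only ever compared pointwise on that carrier.\<close>

definition qfunctor ::
    "('o, 'm) quantaloid \<Rightarrow> ('a, 'o, 'm) qcat \<Rightarrow> ('b, 'o, 'm) qcat \<Rightarrow> ('a \<Rightarrow> 'b) \<Rightarrow> bool" where
  "qfunctor Q \<A> \<B> F \<longleftrightarrow>
    qcategory Q \<A> \<and> qcategory Q \<B> \<and>
    F \<in> carrier \<A> \<rightarrow> carrier \<B> \<and>
    (\<forall>x\<in>carrier \<A>. ctype \<B> (F x) = ctype \<A> x) \<and>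
    (\<forall>x\<in>carrier \<A>. \<forall>x'\<in>carrier \<A>.
      chom \<A> x x' \<sqsubseteq>\<^bsub>qhom Q (ctype \<A> x) (ctype \<A> x')\<^esub> chom \<B> (F x) (F x'))"

definition under_le :: "('o, 'm) quantaloid \<Rightarrow> ('a, 'o, 'm) qcat \<Rightarrow> 'a \<Rightarrow> 'a \<Rightarrow> bool" where
  "under_le Q \<A> x y \<longleftrightarrow>
    ctype \<A> x = ctype \<A> y \<and>
    qid Q (ctype \<A> x) \<sqsubseteq>\<^bsub>qhom Q (ctype \<A> x) (ctype \<A> y)\<^esub> chom \<A> x y"

definition under_iso :: "('o, 'm) quantaloid \<Rightarrow> ('a, 'o, 'm) qcat \<Rightarrow> 'a \<Rightarrow> 'a \<Rightarrow> bool" where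
  "under_iso Q \<A> x y \<longleftrightarrow> under_le Q \<A> x y \<and> under_le Q \<A> y x"

definition functor_le ::
    "('o, 'm) quantaloid \<Rightarrow> ('a, 'o, 'm) qcat \<Rightarrow> ('b, 'o, 'm) qcat
      \<Rightarrow> ('a \<Rightarrow> 'b) \<Rightarrow> ('a \<Rightarrow> 'b) \<Rightarrow> bool" where
  "functor_le Q \<A> \<B> F G \<longleftrightarrow> (\<forall>x\<in>carrier \<A>. under_le Q \<B> (F x) (G x))"

definition functor_iso ::
    "('o, 'm) quantaloid \<Rightarrow> ('a, 'o, 'm) qcat \<Rightarrow> ('b, 'o, 'm) qcat
      \<Rightarrow> ('a \<Rightarrow> 'b) \<Rightarrow> ('a \<Rightarrow> 'b) \<Rightarrow> bool" where
  "functor_iso Q \<A> \<B> F G \<longleftrightarrow> (\<forall>x\<in>carrier \<A>. under_iso Q \<B> (F x) (G x))"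

section \<open>Distributors\<close>

text \<open>Distributors are extensional families (\<^const>\<open>PiE\<close>), so that HOL equality of
  distributors is equality on the carriers.\<close>

definition distributor ::
    "('o, 'm) quantaloid \<Rightarrow> ('a, 'o, 'm) qcat \<Rightarrow> ('b, 'o, 'm) qcat
      \<Rightarrow> ('a \<Rightarrow> 'b \<Rightarrow> 'm) \<Rightarrow> bool" where
  "distributor Q \<A> \<B> \<phi> \<longleftrightarrow>
    qcategory Q \<A> \<and> qcategory Q \<B> \<and>
    \<phi> \<in> (\<Pi>\<^sub>E x\<in>carrier \<A>. \<Pi>\<^sub>E y\<in>carrier \<B>. carrier (qhom Q (ctype \<A> x) (ctype \<B> y))) \<and>
    (\<forall>x\<in>carrier \<A>. \<forall>y'\<in>carrier \<B>. \<forall>y\<in>carrier \<B>.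
      qcomp Q (ctype \<A> x) (ctype \<B> y') (ctype \<B> y) (chom \<B> y' y) (\<phi> x y')
        \<sqsubseteq>\<^bsub>qhom Q (ctype \<A> x) (ctype \<B> y)\<^esub> \<phi> x y) \<and>
    (\<forall>x\<in>carrier \<A>. \<forall>x'\<in>carrier \<A>. \<forall>y\<in>carrier \<B>.
      qcomp Q (ctype \<A> x) (ctype \<A> x') (ctype \<B> y) (\<phi> x' y) (chom \<A> x x')
        \<sqsubseteq>\<^bsub>qhom Q (ctype \<A> x) (ctype \<B> y)\<^esub> \<phi> x y)"

text \<open>\<open>dcomp Q \<A> \<B> \<C> \<psi> \<phi>\<close> is \<open>\<psi> \<circ> \<phi>\<close> for \<open>\<phi>\<close> from \<open>\<A>\<close> to \<open>\<B>\<close> and \<open>\<psi>\<close> from \<open>\<B>\<close> to \<open>\<C>\<close>;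
  \<open>dimp Q \<A> \<B> \<C> \<eta> \<phi>\<close> is \<open>\<eta> \<swarrow> \<phi>\<close>, from \<open>\<B>\<close> to \<open>\<C>\<close>, for \<open>\<phi>\<close> from \<open>\<A>\<close> to \<open>\<B>\<close> and \<open>\<eta>\<close> from
  \<open>\<A>\<close> to \<open>\<C>\<close>.\<close>

definition dcomp ::
    "('o, 'm) quantaloid \<Rightarrow> ('a, 'o, 'm) qcat \<Rightarrow> ('b, 'o, 'm) qcat \<Rightarrow> ('c, 'o, 'm) qcat
      \<Rightarrow> ('b \<Rightarrow> 'c \<Rightarrow> 'm) \<Rightarrow> ('a \<Rightarrow> 'b \<Rightarrow> 'm) \<Rightarrow> ('a \<Rightarrow> 'c \<Rightarrow> 'm)" where
  "dcomp Q \<A> \<B> \<C> \<psi> \<phi> =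
    (\<lambda>x\<in>carrier \<A>. \<lambda>z\<in>carrier \<C>.
      \<Squnion>\<^bsub>qhom Q (ctype \<A> x) (ctype \<C> z)\<^esub>
        ((\<lambda>y. qcomp Q (ctype \<A> x) (ctype \<B> y) (ctype \<C> z) (\<psi> y z) (\<phi> x y)) ` carrier \<B>))"

definition dimp ::
    "('o, 'm) quantaloid \<Rightarrow> ('a, 'o, 'm) qcat \<Rightarrow> ('b, 'o, 'm) qcat \<Rightarrow> ('c, 'o, 'm) qcat
      \<Rightarrow> ('a \<Rightarrow> 'c \<Rightarrow> 'm) \<Rightarrow> ('a \<Rightarrow> 'b \<Rightarrow> 'm) \<Rightarrow> ('b \<Rightarrow> 'c \<Rightarrow> 'm)" where
  "dimp Q \<A> \<B> \<C> \<eta> \<phi> =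
    (\<lambda>y\<in>carrier \<B>. \<lambda>z\<in>carrier \<C>.
      \<Sqinter>\<^bsub>qhom Q (ctype \<B> y) (ctype \<C> z)\<^esub>
        ((\<lambda>x. qimp Q (ctype \<A> x) (ctype \<B> y) (ctype \<C> z) (\<eta> x z) (\<phi> x y)) ` carrier \<A>))"

definition fgraph ::
    "('a, 'o, 'm) qcat \<Rightarrow> ('b, 'o, 'm) qcat \<Rightarrow> ('a \<Rightarrow> 'b) \<Rightarrow> ('a \<Rightarrow> 'b \<Rightarrow> 'm)" where
  "fgraph \<A> \<B> F = (\<lambda>x\<in>carrier \<A>. \<lambda>y\<in>carrier \<B>. chom \<B> (F x) y)"

definition fcograph ::
    "('a, 'o, 'm) qcat \<Rightarrow> ('b, 'o, 'm) qcat \<Rightarrow> ('a \<Rightarrow> 'b) \<Rightarrow> ('b \<Rightarrow> 'a \<Rightarrow> 'm)" where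
  "fcograph \<A> \<B> F = (\<lambda>y\<in>carrier \<B>. \<lambda>x\<in>carrier \<A>. chom \<B> y (F x))"

text \<open>For \<open>\<phi>\<close> from \<open>\<A>\<close> to \<open>\<B>\<close> and \<open>\<psi>\<close> from \<open>\<A>'\<close> to \<open>\<B>'\<close>.\<close>

definition infomorphism ::
    "('o, 'm) quantaloid
      \<Rightarrow> ('a, 'o, 'm) qcat \<Rightarrow> ('b, 'o, 'm) qcat \<Rightarrow> ('a \<Rightarrow> 'b \<Rightarrow> 'm)
      \<Rightarrow> ('c, 'o, 'm) qcat \<Rightarrow> ('d, 'o, 'm) qcat \<Rightarrow> ('c \<Rightarrow> 'd \<Rightarrow> 'm)
      \<Rightarrow> ('a \<Rightarrow> 'c) \<Rightarrow> ('d \<Rightarrow> 'b) \<Rightarrow> bool" where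
  "infomorphism Q \<A> \<B> \<phi> \<A>' \<B>' \<psi> F G \<longleftrightarrow>
    distributor Q \<A> \<B> \<phi> \<and> distributor Q \<A>' \<B>' \<psi> \<and>
    qfunctor Q \<A> \<A>' F \<and> qfunctor Q \<B>' \<B> G \<and>
    dcomp Q \<A> \<B> \<B>' (fcograph \<B>' \<B> G) \<phi> = dcomp Q \<A> \<A>' \<B>' \<psi> (fgraph \<A> \<A>' F)"

section \<open>Presheaves\<close>

definition star :: "('o, 'm) quantaloid \<Rightarrow> 'o \<Rightarrow> (unit, 'o, 'm) qcat" where
  "star Q X = \<lparr>carrier = {()}, ctype = (\<lambda>_. X), chom = (\<lambda>_ _. qid Q X)\<rparr>"

text \<open>An object of \<open>presheaves Q \<A>\<close> is a pair of its type \<open>X\<close> and a distributor from \<open>\<A>\<close> to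
  \<open>star Q X\<close>. A distributor from \<open>star Q X\<close> to \<open>star Q Y\<close> is identified with its only component,
  an arrow in \<open>Q(X,Y)\<close>.\<close>

type_synonym ('a, 'o, 'm) presheaf = "'o \<times> ('a \<Rightarrow> unit \<Rightarrow> 'm)"

definition presheaves ::
    "('o, 'm) quantaloid \<Rightarrow> ('a, 'o, 'm) qcat \<Rightarrow> (('a, 'o, 'm) presheaf, 'o, 'm) qcat" where
  "presheaves Q \<A> =
    \<lparr>carrier = {(X, \<mu>). X \<in> qob Q \<and> distributor Q \<A> (star Q X) \<mu>},
     ctype = fst,
     chom = (\<lambda>(X, \<mu>) (Y, \<kappa>). dimp Q \<A> (star Q X) (star Q Y) \<kappa> \<mu> () ())\<rparr>"

text \<open>\<open>direct_image Q \<A> \<B> F\<close> is \<open>F\<^sup>\<rightarrow>\<close>.\<close>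

definition direct_image ::
    "('o, 'm) quantaloid \<Rightarrow> ('a, 'o, 'm) qcat \<Rightarrow> ('b, 'o, 'm) qcat \<Rightarrow> ('a \<Rightarrow> 'b)
      \<Rightarrow> ('a, 'o, 'm) presheaf \<Rightarrow> ('b, 'o, 'm) presheaf" where
  "direct_image Q \<A> \<B> F = (\<lambda>(X, \<mu>). (X, dcomp Q \<B> \<A> (star Q X) \<mu> (fcograph \<A> \<B> F)))"

text \<open>For \<open>\<phi>\<close> from \<open>\<A>\<close> to \<open>\<B>\<close>, \<open>upper_star Q \<A> \<B> \<phi>\<close> is \<open>\<phi>\<^sup>*\<close>, from presheaves on \<open>\<B>\<close> to
  presheaves on \<open>\<A>\<close>, and \<open>lower_star Q \<A> \<B> \<phi>\<close> is \<open>\<phi>\<^sub>*\<close>, in the opposite direction.\<close>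

definition upper_star ::
    "('o, 'm) quantaloid \<Rightarrow> ('a, 'o, 'm) qcat \<Rightarrow> ('b, 'o, 'm) qcat \<Rightarrow> ('a \<Rightarrow> 'b \<Rightarrow> 'm)
      \<Rightarrow> ('b, 'o, 'm) presheaf \<Rightarrow> ('a, 'o, 'm) presheaf" where
  "upper_star Q \<A> \<B> \<phi> = (\<lambda>(X, \<kappa>). (X, dcomp Q \<A> \<B> (star Q X) \<kappa> \<phi>))"

definition lower_star ::
    "('o, 'm) quantaloid \<Rightarrow> ('a, 'o, 'm) qcat \<Rightarrow> ('b, 'o, 'm) qcat \<Rightarrow> ('a \<Rightarrow> 'b \<Rightarrow> 'm)
      \<Rightarrow> ('a, 'o, 'm) presheaf \<Rightarrow> ('b, 'o, 'm) presheaf" where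
  "lower_star Q \<A> \<B> \<phi> = (\<lambda>(X, \<mu>). (X, dimp Q \<A> \<B> (star Q X) \<mu> \<phi>))"

section \<open>Closure spaces\<close>

definition closure_operator ::
    "('o, 'm) quantaloid \<Rightarrow> ('a, 'o, 'm) qcat \<Rightarrow> ('a \<Rightarrow> 'a) \<Rightarrow> bool" where
  "closure_operator Q \<C> c \<longleftrightarrow>
    qfunctor Q \<C> \<C> c \<and>
    functor_le Q \<C> \<C> id c \<and>
    functor_iso Q \<C> \<C> (c \<circ> c) c"

type_synonym ('a, 'o, 'm) qclosure_space =
  "('a, 'o, 'm) qcat \<times> (('a, 'o, 'm) presheaf \<Rightarrow> ('a, 'o, 'm) presheaf)"

definition closure_space ::
    "('o, 'm) quantaloid \<Rightarrow> ('a, 'o, 'm) qclosure_space \<Rightarrow> bool" where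
  "closure_space Q = (\<lambda>(\<A>, c). qcategory Q \<A> \<and> closure_operator Q (presheaves Q \<A>) c)"

definition continuous_qfunctor ::
    "('o, 'm) quantaloid \<Rightarrow> ('a, 'o, 'm) qclosure_space \<Rightarrow> ('b, 'o, 'm) qclosure_space
      \<Rightarrow> ('a \<Rightarrow> 'b) \<Rightarrow> bool" where
  "continuous_qfunctor Q = (\<lambda>(\<A>, c) (\<B>, d) F.
    closure_space Q (\<A>, c) \<and> closure_space Q (\<B>, d) \<and>
    qfunctor Q \<A> \<B> F \<and>
    functor_le Q (presheaves Q \<A>) (presheaves Q \<B>)
      (direct_image Q \<A> \<B> F \<circ> c) (d \<circ> direct_image Q \<A> \<B> F))"

end

theory Submission
  imports Defs
begin

text \<open>Write \<open>\<phi>\<^sup>*\<close> for precomposition with \<open>\<phi>\<close> and \<open>\<phi>\<^sub>*\<close> for the residual \<open>- \<swarrow> \<phi>\<close>.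
  Composition of distributors is associative, and
  \<open>\<psi> \<circ> \<phi> \<le> \<eta>\<close> holds exactly when \<open>\<psi> \<le> \<eta> \<swarrow> \<phi>\<close>; everything follows from these two facts
  (\<open>dcomp_assoc\<close>, \<open>le_dimp_iff\<close>).

  For a presheaf \<open>\<kappa>\<close> on \<open>\<B>'\<close>, continuity of \<open>G\<close> at \<open>\<kappa>\<close> says
  \<open>((\<kappa> \<circ> \<psi>) \<swarrow> \<psi>) \<circ> G\<^sup>\<natural> \<le> (\<kappa> \<circ> G\<^sup>\<natural> \<circ> \<phi>) \<swarrow> \<phi>\<close>, which by residuation is
  \<open>((\<kappa> \<circ> \<psi>) \<swarrow> \<psi>) \<circ> G\<^sup>\<natural> \<circ> \<phi> \<le> \<kappa> \<circ> G\<^sup>\<natural> \<circ> \<phi>\<close>. An infomorphism is precisely a pair with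
  \<open>G\<^sup>\<natural> \<circ> \<phi> = \<psi> \<circ> F\<^sub>\<natural>\<close>; after this replacement on both sides, the inequality is the counit
  \<open>((\<kappa> \<circ> \<psi>) \<swarrow> \<psi>) \<circ> \<psi> \<le> \<kappa> \<circ> \<psi>\<close> composed with \<open>F\<^sub>\<natural>\<close>. This is \<open>infomorphism_closure_le\<close>.

  The other part of the claim is that the two endomaps are closure operators
  (\<open>kan_closure_operator\<close>). This is the usual argument for the composite of an adjunction,
  with \<open>\<phi>\<^sup>*\<close> the left and \<open>\<phi>\<^sub>*\<close> the right adjoint, once presheaves are known
  to form a category and \<open>\<phi>\<^sup>*\<close>, \<open>\<phi>\<^sub>*\<close> to be functors.
  For these the order and the hom-arrows of presheaves are read off as inequalities between
  composites with arrows \<open>star Q X \<rightarrow> star Q Y\<close> (\<open>presheaf_under_le_iff\<close>,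
  \<open>presheaf_qfunctorI\<close>).

  Associativity and residuation concern entries and their joins only, so they are proved
  for arbitrary typed families of arrows, called matrices. A category is then itself
  a matrix, and a distributor is a matrix on which the matrices of its domain and
  codomain act (\<open>distributor_iff\<close>). Thus the closure of distributors under composition and
  residuation is also a consequence of associativity and residuation.\<close>

section \<open>Matrices of arrows\<close>

text \<open>Extensionality is left out so that the hom-arrows of a category, whose values outside the
  carrier are arbitrary, form a matrix.\<close>

definition qmatrix ::
    "('o, 'm) quantaloid \<Rightarrow> ('a, 'o, 'm) qcat \<Rightarrow> ('b, 'o, 'm) qcat \<Rightarrow> ('a \<Rightarrow> 'b \<Rightarrow> 'm) \<Rightarrow> bool" where
  "qmatrix Q \<A> \<B> \<phi> \<longleftrightarrow>
    (\<forall>x\<in>carrier \<A>. ctype \<A> x \<in> qob Q) \<and> (\<forall>y\<in>carrier \<B>. ctype \<B> y \<in> qob Q) \<and>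
    (\<forall>x\<in>carrier \<A>. \<forall>y\<in>carrier \<B>. \<phi> x y \<in> carrier (qhom Q (ctype \<A> x) (ctype \<B> y)))"

definition matrix_le ::
    "('o, 'm) quantaloid \<Rightarrow> ('a, 'o, 'm) qcat \<Rightarrow> ('b, 'o, 'm) qcat
      \<Rightarrow> ('a \<Rightarrow> 'b \<Rightarrow> 'm) \<Rightarrow> ('a \<Rightarrow> 'b \<Rightarrow> 'm) \<Rightarrow> bool" where
  "matrix_le Q \<A> \<B> \<phi> \<psi> \<longleftrightarrow>
    (\<forall>x\<in>carrier \<A>. \<forall>y\<in>carrier \<B>. \<phi> x y \<sqsubseteq>\<^bsub>qhom Q (ctype \<A> x) (ctype \<B> y)\<^esub> \<psi> x y)"

lemma star_simps [simp]:
  "carrier (star Q X) = {()}" "ctype (star Q X) u = X" "chom (star Q X) u v = qid Q X"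
  by (simp_all add: star_def)

lemma presheaves_simps [simp]:
  "(X, \<mu>) \<in> carrier (presheaves Q \<A>) \<longleftrightarrow> X \<in> qob Q \<and> distributor Q \<A> (star Q X) \<mu>"
  "ctype (presheaves Q \<A>) (X, \<mu>) = X"
  "chom (presheaves Q \<A>) (X, \<mu>) (Y, \<kappa>) = dimp Q \<A> (star Q X) (star Q Y) \<kappa> \<mu> () ()"
  by (simp_all add: presheaves_def)

lemma qmatrixD:
  assumes "qmatrix Q \<A> \<B> \<phi>"
  shows "x \<in> carrier \<A> \<Longrightarrow> ctype \<A> x \<in> qob Q"
    and "y \<in> carrier \<B> \<Longrightarrow> ctype \<B> y \<in> qob Q"
    and "x \<in> carrier \<A> \<Longrightarrow> y \<in> carrier \<B> \<Longrightarrow> \<phi> x y \<in> carrier (qhom Q (ctype \<A> x) (ctype \<B> y))"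
  using assms by (auto simp: qmatrix_def)

lemma matrix_leD:
  "\<lbrakk>matrix_le Q \<A> \<B> \<phi> \<psi>; x \<in> carrier \<A>; y \<in> carrier \<B>\<rbrakk>
    \<Longrightarrow> \<phi> x y \<sqsubseteq>\<^bsub>qhom Q (ctype \<A> x) (ctype \<B> y)\<^esub> \<psi> x y"
  by (auto simp: matrix_le_def)

lemma qcategory_chom_matrix: "qcategory Q \<A> \<Longrightarrow> qmatrix Q \<A> \<A> (chom \<A>)"
  by (auto simp: qcategory_def qmatrix_def)

lemma distributorD:
  assumes "distributor Q \<A> \<B> \<phi>"
  shows "qcategory Q \<A>" "qcategory Q \<B>" "qmatrix Q \<A> \<B> \<phi>"
  using assms by (auto simp: distributor_def qmatrix_def qcategory_def PiE_iff)

context quantaloid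
begin

section \<open>Residuation in the hom-lattices\<close>

lemma hom_refl:
  "\<lbrakk>A \<in> qob Q; B \<in> qob Q; f \<in> carrier (qhom Q A B)\<rbrakk> \<Longrightarrow> f \<sqsubseteq>\<^bsub>qhom Q A B\<^esub> f"
  using hom_complete_lattice[of A B]
  by (meson complete_lattice.axioms(1) partial_order_def weak_partial_order.le_refl)

lemma hom_trans:
  assumes "A \<in> qob Q" "B \<in> qob Q"
    and "f \<in> carrier (qhom Q A B)" "g \<in> carrier (qhom Q A B)" "h \<in> carrier (qhom Q A B)"
    and "f \<sqsubseteq>\<^bsub>qhom Q A B\<^esub> g" "g \<sqsubseteq>\<^bsub>qhom Q A B\<^esub> h"
  shows "f \<sqsubseteq>\<^bsub>qhom Q A B\<^esub> h"
proof -
  interpret complete_lattice "qhom Q A B" using hom_complete_lattice assms by blast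
  show ?thesis using assms le_trans by blast
qed

lemma hom_antisym:
  assumes "A \<in> qob Q" "B \<in> qob Q"
    and "f \<in> carrier (qhom Q A B)" "g \<in> carrier (qhom Q A B)"
    and "f \<sqsubseteq>\<^bsub>qhom Q A B\<^esub> g" "g \<sqsubseteq>\<^bsub>qhom Q A B\<^esub> f"
  shows "f = g"
proof -
  interpret complete_lattice "qhom Q A B" using hom_complete_lattice assms by blast
  show ?thesis using assms le_antisym by blast
qed

lemma hom_Sup_closed:
  assumes "A \<in> qob Q" "B \<in> qob Q" "S \<subseteq> carrier (qhom Q A B)"
  shows "\<Squnion>\<^bsub>qhom Q A B\<^esub> S \<in> carrier (qhom Q A B)"
proof -
  interpret complete_lattice "qhom Q A B" using hom_complete_lattice assms by blast
  show ?thesis using assms by simp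
qed

lemma hom_Inf_closed:
  assumes "A \<in> qob Q" "B \<in> qob Q" "S \<subseteq> carrier (qhom Q A B)"
  shows "\<Sqinter>\<^bsub>qhom Q A B\<^esub> S \<in> carrier (qhom Q A B)"
proof -
  interpret complete_lattice "qhom Q A B" using hom_complete_lattice assms by blast
  show ?thesis using assms by simp
qed

lemma hom_Sup_le_iff:
  assumes "A \<in> qob Q" "B \<in> qob Q" "S \<subseteq> carrier (qhom Q A B)" "k \<in> carrier (qhom Q A B)"
  shows "\<Squnion>\<^bsub>qhom Q A B\<^esub> S \<sqsubseteq>\<^bsub>qhom Q A B\<^esub> k \<longleftrightarrow> (\<forall>f\<in>S. f \<sqsubseteq>\<^bsub>qhom Q A B\<^esub> k)"
proof -
  interpret complete_lattice "qhom Q A B" using hom_complete_lattice assms by blast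
  show ?thesis
    using assms sup_upper[of S] sup_least[of S k] sup_closed[of S] le_trans by (meson subsetD)
qed

lemma hom_le_Inf_iff:
  assumes "A \<in> qob Q" "B \<in> qob Q" "S \<subseteq> carrier (qhom Q A B)" "k \<in> carrier (qhom Q A B)"
  shows "k \<sqsubseteq>\<^bsub>qhom Q A B\<^esub> \<Sqinter>\<^bsub>qhom Q A B\<^esub> S \<longleftrightarrow> (\<forall>f\<in>S. k \<sqsubseteq>\<^bsub>qhom Q A B\<^esub> f)"
proof -
  interpret complete_lattice "qhom Q A B" using hom_complete_lattice assms by blast
  show ?thesis
    using assms inf_lower[of S] inf_greatest[of S k] inf_closed[of S] le_trans by (meson subsetD)
qed

text \<open>Preservation of joins enters through this test against upper bounds and its mirror image
  below. It turns nested joins of composites into quantifiers.\<close>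

lemma comp_Sup_le_iff:
  assumes ob: "A \<in> qob Q" "B \<in> qob Q" "C \<in> qob Q" and S: "S \<subseteq> carrier (qhom Q A B)"
    and g: "g \<in> carrier (qhom Q B C)" and k: "k \<in> carrier (qhom Q A C)"
  shows "qcomp Q A B C g (\<Squnion>\<^bsub>qhom Q A B\<^esub> S) \<sqsubseteq>\<^bsub>qhom Q A C\<^esub> k
    \<longleftrightarrow> (\<forall>f\<in>S. qcomp Q A B C g f \<sqsubseteq>\<^bsub>qhom Q A C\<^esub> k)"
proof -
  have "qcomp Q A B C g (\<Squnion>\<^bsub>qhom Q A B\<^esub> S) = \<Squnion>\<^bsub>qhom Q A C\<^esub> (qcomp Q A B C g ` S)"
    using comp_sup_right[OF ob g] S by (auto simp: sup_pres_def)
  moreover have "qcomp Q A B C g ` S \<subseteq> carrier (qhom Q A C)"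
    using S comp_closed[OF ob] g by auto
  ultimately show ?thesis using hom_Sup_le_iff[OF ob(1,3) _ k] by auto
qed

lemma Sup_comp_le_iff:
  assumes ob: "A \<in> qob Q" "B \<in> qob Q" "C \<in> qob Q" and S: "S \<subseteq> carrier (qhom Q B C)"
    and f: "f \<in> carrier (qhom Q A B)" and k: "k \<in> carrier (qhom Q A C)"
  shows "qcomp Q A B C (\<Squnion>\<^bsub>qhom Q B C\<^esub> S) f \<sqsubseteq>\<^bsub>qhom Q A C\<^esub> k
    \<longleftrightarrow> (\<forall>g\<in>S. qcomp Q A B C g f \<sqsubseteq>\<^bsub>qhom Q A C\<^esub> k)"
proof -
  have "qcomp Q A B C (\<Squnion>\<^bsub>qhom Q B C\<^esub> S) f = \<Squnion>\<^bsub>qhom Q A C\<^esub> ((\<lambda>g. qcomp Q A B C g f) ` S)"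
    using comp_sup_left[OF ob f] S by (auto simp: sup_pres_def)
  moreover have "(\<lambda>g. qcomp Q A B C g f) ` S \<subseteq> carrier (qhom Q A C)"
    using S comp_closed[OF ob] f by auto
  ultimately show ?thesis using hom_Sup_le_iff[OF ob(1,3) _ k] by auto
qed

lemma comp_mono_left:
  assumes ob: "A \<in> qob Q" "B \<in> qob Q" "C \<in> qob Q" and f: "f \<in> carrier (qhom Q A B)"
    and g: "g \<in> carrier (qhom Q B C)" "g' \<in> carrier (qhom Q B C)" "g \<sqsubseteq>\<^bsub>qhom Q B C\<^esub> g'"
  shows "qcomp Q A B C g f \<sqsubseteq>\<^bsub>qhom Q A C\<^esub> qcomp Q A B C g' f"
proof -
  have S: "{g, g'} \<subseteq> carrier (qhom Q B C)" using g by auto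
  have "\<Squnion>\<^bsub>qhom Q B C\<^esub> {g, g'} = g'"
    using hom_Sup_le_iff[OF ob(2,3) S] hom_Sup_closed[OF ob(2,3) S] hom_refl[OF ob(2,3)] g
    by (intro hom_antisym[OF ob(2,3)]) auto
  then show ?thesis
    using Sup_comp_le_iff[OF ob S f comp_closed[OF ob f g(2)]]
      hom_refl[OF ob(1,3) comp_closed[OF ob f g(2)]] by simp
qed

lemma comp_mono_right:
  assumes ob: "A \<in> qob Q" "B \<in> qob Q" "C \<in> qob Q" and g: "g \<in> carrier (qhom Q B C)"
    and f: "f \<in> carrier (qhom Q A B)" "f' \<in> carrier (qhom Q A B)" "f \<sqsubseteq>\<^bsub>qhom Q A B\<^esub> f'"
  shows "qcomp Q A B C g f \<sqsubseteq>\<^bsub>qhom Q A C\<^esub> qcomp Q A B C g f'"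
proof -
  have S: "{f, f'} \<subseteq> carrier (qhom Q A B)" using f by auto
  have "\<Squnion>\<^bsub>qhom Q A B\<^esub> {f, f'} = f'"
    using hom_Sup_le_iff[OF ob(1,2) S] hom_Sup_closed[OF ob(1,2) S] hom_refl[OF ob(1,2)] f
    by (intro hom_antisym[OF ob(1,2)]) auto
  then show ?thesis
    using comp_Sup_le_iff[OF ob S g comp_closed[OF ob f(2) g]]
      hom_refl[OF ob(1,3) comp_closed[OF ob f(2) g]] by simp
qed

text \<open>The join of all \<open>h\<close> with \<open>h \<circ> f \<le> g\<close> again satisfies this inequality, because
  \<open>- \<circ> f\<close> preserves joins. Hence the greatest element named by the definite description in
  \<^const>\<open>qimp\<close> exists.\<close>

lemma qimp_closed_and_le_iff:
  assumes ob: "A \<in> qob Q" "B \<in> qob Q" "X \<in> qob Q"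
    and f: "f \<in> carrier (qhom Q A B)" and g: "g \<in> carrier (qhom Q A X)"
  shows qimp_closed: "qimp Q A B X g f \<in> carrier (qhom Q B X)"
    and le_qimp_iff: "h \<in> carrier (qhom Q B X) \<Longrightarrow>
      h \<sqsubseteq>\<^bsub>qhom Q B X\<^esub> qimp Q A B X g f \<longleftrightarrow> qcomp Q A B X h f \<sqsubseteq>\<^bsub>qhom Q A X\<^esub> g"
proof -
  define S where "S = {h \<in> carrier (qhom Q B X). qcomp Q A B X h f \<sqsubseteq>\<^bsub>qhom Q A X\<^esub> g}"
  define s where "s = \<Squnion>\<^bsub>qhom Q B X\<^esub> S"
  have S: "S \<subseteq> carrier (qhom Q B X)" by (auto simp: S_def)
  have s: "s \<in> carrier (qhom Q B X)" using hom_Sup_closed[OF ob(2,3) S] by (simp add: s_def)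
  have sf: "qcomp Q A B X s f \<sqsubseteq>\<^bsub>qhom Q A X\<^esub> g"
    using Sup_comp_le_iff[OF ob S f g] by (auto simp: s_def S_def)
  have up: "\<forall>h\<in>S. h \<sqsubseteq>\<^bsub>qhom Q B X\<^esub> s"
    using hom_Sup_le_iff[OF ob(2,3) S s] hom_refl[OF ob(2,3) s] by (simp add: s_def)
  have gr: "greatest (qhom Q B X) s S" using S s sf up by (auto simp: greatest_def S_def)
  then have "qimp Q A B X g f = s"
    unfolding qimp_def S_def[symmetric]
    by (rule the_equality) (use gr S hom_antisym[OF ob(2,3)] in \<open>auto simp: greatest_def\<close>)
  moreover have "qcomp Q A B X h f \<sqsubseteq>\<^bsub>qhom Q A X\<^esub> g"
    if "h \<in> carrier (qhom Q B X)" "h \<sqsubseteq>\<^bsub>qhom Q B X\<^esub> s" for h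
    using hom_trans[OF ob(1,3) _ _ _ comp_mono_left[OF ob f that(1) s that(2)] sf]
      comp_closed[OF ob f] that s g by auto
  ultimately show "qimp Q A B X g f \<in> carrier (qhom Q B X)"
    and "h \<in> carrier (qhom Q B X) \<Longrightarrow>
      h \<sqsubseteq>\<^bsub>qhom Q B X\<^esub> qimp Q A B X g f \<longleftrightarrow> qcomp Q A B X h f \<sqsubseteq>\<^bsub>qhom Q A X\<^esub> g"
    using s up by (auto simp: S_def)
qed

section \<open>The calculus of matrices\<close>

lemma matrix_le_refl: "qmatrix Q \<A> \<B> \<phi> \<Longrightarrow> matrix_le Q \<A> \<B> \<phi> \<phi>"
  unfolding matrix_le_def using qmatrixD hom_refl by metis

lemma matrix_le_trans:
  assumes "qmatrix Q \<A> \<B> \<phi>" "qmatrix Q \<A> \<B> \<psi>" "qmatrix Q \<A> \<B> \<eta>"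
    and "matrix_le Q \<A> \<B> \<phi> \<psi>" "matrix_le Q \<A> \<B> \<psi> \<eta>"
  shows "matrix_le Q \<A> \<B> \<phi> \<eta>"
  unfolding matrix_le_def
proof (intro ballI)
  fix x y assume "x \<in> carrier \<A>" "y \<in> carrier \<B>"
  then show "\<phi> x y \<sqsubseteq>\<^bsub>qhom Q (ctype \<A> x) (ctype \<B> y)\<^esub> \<eta> x y"
    using hom_trans[of "ctype \<A> x" "ctype \<B> y" "\<phi> x y" "\<psi> x y" "\<eta> x y"]
      qmatrixD[OF assms(1)] qmatrixD(3)[OF assms(2)] qmatrixD(3)[OF assms(3)]
      matrix_leD[OF assms(4)] matrix_leD[OF assms(5)]
    by blast
qed

lemma dcomp_summands:
  assumes "qmatrix Q \<A> \<B> \<phi>" "qmatrix Q \<B> \<C> \<psi>" "x \<in> carrier \<A>" "z \<in> carrier \<C>"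
  shows "(\<lambda>y. qcomp Q (ctype \<A> x) (ctype \<B> y) (ctype \<C> z) (\<psi> y z) (\<phi> x y)) ` carrier \<B>
    \<subseteq> carrier (qhom Q (ctype \<A> x) (ctype \<C> z))"
  using qmatrixD[OF assms(1)] qmatrixD[OF assms(2)] assms(3,4) comp_closed by auto

lemma dcomp_matrix:
  assumes "qmatrix Q \<A> \<B> \<phi>" "qmatrix Q \<B> \<C> \<psi>"
  shows "qmatrix Q \<A> \<C> (dcomp Q \<A> \<B> \<C> \<psi> \<phi>)"
  using dcomp_summands[OF assms] hom_Sup_closed qmatrixD[OF assms(1)] qmatrixD[OF assms(2)]
  by (auto simp: qmatrix_def dcomp_def)

text \<open>The composite is determined by its upper bounds, as the residual is by its lower bounds
  (\<open>le_dimp_iff\<close>). Inequalities between distributors are derived from these two descriptions.\<close>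

lemma dcomp_le_iff:
  assumes "qmatrix Q \<A> \<B> \<phi>" "qmatrix Q \<B> \<C> \<psi>" "qmatrix Q \<A> \<C> \<eta>"
  shows "matrix_le Q \<A> \<C> (dcomp Q \<A> \<B> \<C> \<psi> \<phi>) \<eta> \<longleftrightarrow>
    (\<forall>x\<in>carrier \<A>. \<forall>y\<in>carrier \<B>. \<forall>z\<in>carrier \<C>.
      qcomp Q (ctype \<A> x) (ctype \<B> y) (ctype \<C> z) (\<psi> y z) (\<phi> x y)
        \<sqsubseteq>\<^bsub>qhom Q (ctype \<A> x) (ctype \<C> z)\<^esub> \<eta> x z)"
proof -
  have "dcomp Q \<A> \<B> \<C> \<psi> \<phi> x z \<sqsubseteq>\<^bsub>qhom Q (ctype \<A> x) (ctype \<C> z)\<^esub> \<eta> x z \<longleftrightarrow>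
    (\<forall>y\<in>carrier \<B>. qcomp Q (ctype \<A> x) (ctype \<B> y) (ctype \<C> z) (\<psi> y z) (\<phi> x y)
      \<sqsubseteq>\<^bsub>qhom Q (ctype \<A> x) (ctype \<C> z)\<^esub> \<eta> x z)"
    if "x \<in> carrier \<A>" "z \<in> carrier \<C>" for x z
    using hom_Sup_le_iff[OF _ _ dcomp_summands[OF assms(1,2) that]] that
      qmatrixD[OF assms(3)] by (auto simp: dcomp_def)
  then show ?thesis unfolding matrix_le_def by blast
qed

lemma dimp_factors:
  assumes "qmatrix Q \<A> \<B> \<phi>" "qmatrix Q \<A> \<C> \<eta>" "y \<in> carrier \<B>" "z \<in> carrier \<C>"
  shows "(\<lambda>x. qimp Q (ctype \<A> x) (ctype \<B> y) (ctype \<C> z) (\<eta> x z) (\<phi> x y)) ` carrier \<A>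
    \<subseteq> carrier (qhom Q (ctype \<B> y) (ctype \<C> z))"
  using qmatrixD[OF assms(1)] qmatrixD[OF assms(2)] assms(3,4) qimp_closed by auto

lemma dimp_matrix:
  assumes "qmatrix Q \<A> \<B> \<phi>" "qmatrix Q \<A> \<C> \<eta>"
  shows "qmatrix Q \<B> \<C> (dimp Q \<A> \<B> \<C> \<eta> \<phi>)"
  using dimp_factors[OF assms] hom_Inf_closed qmatrixD[OF assms(1)] qmatrixD[OF assms(2)]
  by (auto simp: qmatrix_def dimp_def)

lemma le_dimp_iff:
  assumes \<phi>: "qmatrix Q \<A> \<B> \<phi>" and \<eta>: "qmatrix Q \<A> \<C> \<eta>" and \<psi>: "qmatrix Q \<B> \<C> \<psi>"
  shows "matrix_le Q \<B> \<C> \<psi> (dimp Q \<A> \<B> \<C> \<eta> \<phi>) \<longleftrightarrow>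
    matrix_le Q \<A> \<C> (dcomp Q \<A> \<B> \<C> \<psi> \<phi>) \<eta>"
proof -
  have "\<psi> y z \<sqsubseteq>\<^bsub>qhom Q (ctype \<B> y) (ctype \<C> z)\<^esub> dimp Q \<A> \<B> \<C> \<eta> \<phi> y z \<longleftrightarrow>
    (\<forall>x\<in>carrier \<A>. qcomp Q (ctype \<A> x) (ctype \<B> y) (ctype \<C> z) (\<psi> y z) (\<phi> x y)
      \<sqsubseteq>\<^bsub>qhom Q (ctype \<A> x) (ctype \<C> z)\<^esub> \<eta> x z)"
    if "y \<in> carrier \<B>" "z \<in> carrier \<C>" for y z
    using hom_le_Inf_iff[OF _ _ dimp_factors[OF \<phi> \<eta> that]] that le_qimp_iff
      qmatrixD[OF \<psi>] qmatrixD[OF \<phi>] qmatrixD[OF \<eta>] by (auto simp: dimp_def)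
  then show ?thesis unfolding dcomp_le_iff[OF \<phi> \<psi> \<eta>] unfolding matrix_le_def by blast
qed

text \<open>Both bracketings have the same upper bounds: a matrix bounds either one exactly when it
  bounds all triple composites \<open>\<chi> z w \<circ> \<psi> y z \<circ> \<phi> x y\<close>. Taking each bracketing as a bound
  for the other and using antisymmetry gives equality.\<close>

lemma dcomp_assoc:
  assumes \<phi>: "qmatrix Q \<A> \<B> \<phi>" and \<psi>: "qmatrix Q \<B> \<C> \<psi>" and \<chi>: "qmatrix Q \<C> \<D> \<chi>"
  shows "dcomp Q \<A> \<C> \<D> \<chi> (dcomp Q \<A> \<B> \<C> \<psi> \<phi>) = dcomp Q \<A> \<B> \<D> (dcomp Q \<B> \<C> \<D> \<chi> \<psi>) \<phi>"
    (is "?L = ?R")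
proof -
  note D = qmatrixD[OF \<phi>] qmatrixD[OF \<psi>] qmatrixD[OF \<chi>]
  note \<psi>\<phi> = dcomp_matrix[OF \<phi> \<psi>] and \<chi>\<psi> = dcomp_matrix[OF \<psi> \<chi>]
  note L = dcomp_matrix[OF \<psi>\<phi> \<chi>] and R = dcomp_matrix[OF \<phi> \<chi>\<psi>]
  have left: "matrix_le Q \<A> \<D> ?L \<eta> \<longleftrightarrow> (\<forall>x\<in>carrier \<A>. \<forall>z\<in>carrier \<C>. \<forall>w\<in>carrier \<D>. \<forall>y\<in>carrier \<B>.
      qcomp Q (ctype \<A> x) (ctype \<C> z) (ctype \<D> w) (\<chi> z w)
        (qcomp Q (ctype \<A> x) (ctype \<B> y) (ctype \<C> z) (\<psi> y z) (\<phi> x y))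
        \<sqsubseteq>\<^bsub>qhom Q (ctype \<A> x) (ctype \<D> w)\<^esub> \<eta> x w)" if "qmatrix Q \<A> \<D> \<eta>" for \<eta>
    unfolding dcomp_le_iff[OF \<psi>\<phi> \<chi> that]
    using comp_Sup_le_iff[OF _ _ _ dcomp_summands[OF \<phi> \<psi>]] D qmatrixD[OF that]
    by (auto simp: dcomp_def)
  have right: "matrix_le Q \<A> \<D> ?R \<eta> \<longleftrightarrow> (\<forall>x\<in>carrier \<A>. \<forall>y\<in>carrier \<B>. \<forall>w\<in>carrier \<D>. \<forall>z\<in>carrier \<C>.
      qcomp Q (ctype \<A> x) (ctype \<B> y) (ctype \<D> w)
        (qcomp Q (ctype \<B> y) (ctype \<C> z) (ctype \<D> w) (\<chi> z w) (\<psi> y z)) (\<phi> x y)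
        \<sqsubseteq>\<^bsub>qhom Q (ctype \<A> x) (ctype \<D> w)\<^esub> \<eta> x w)" if "qmatrix Q \<A> \<D> \<eta>" for \<eta>
    unfolding dcomp_le_iff[OF \<phi> \<chi>\<psi> that]
    using Sup_comp_le_iff[OF _ _ _ dcomp_summands[OF \<psi> \<chi>]] D qmatrixD[OF that]
    by (auto simp: dcomp_def)
  have assoc: "qcomp Q (ctype \<A> x) (ctype \<C> z) (ctype \<D> w) (\<chi> z w)
        (qcomp Q (ctype \<A> x) (ctype \<B> y) (ctype \<C> z) (\<psi> y z) (\<phi> x y)) =
      qcomp Q (ctype \<A> x) (ctype \<B> y) (ctype \<D> w)
        (qcomp Q (ctype \<B> y) (ctype \<C> z) (ctype \<D> w) (\<chi> z w) (\<psi> y z)) (\<phi> x y)"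
    if "x \<in> carrier \<A>" "y \<in> carrier \<B>" "z \<in> carrier \<C>" "w \<in> carrier \<D>" for x y z w
    using comp_assoc D that by auto
  have same: "matrix_le Q \<A> \<D> ?L \<eta> \<longleftrightarrow> matrix_le Q \<A> \<D> ?R \<eta>" if "qmatrix Q \<A> \<D> \<eta>" for \<eta>
    unfolding left[OF that] right[OF that] using assoc by (auto cong: ball_cong)
  have LR: "matrix_le Q \<A> \<D> ?L ?R" "matrix_le Q \<A> \<D> ?R ?L"
    using same[OF R] same[OF L] matrix_le_refl[OF R] matrix_le_refl[OF L] by auto
  have "?L x w = ?R x w" if "x \<in> carrier \<A>" "w \<in> carrier \<D>" for x w
    using hom_antisym[of "ctype \<A> x" "ctype \<D> w"] LR[THEN matrix_leD, OF that]
      qmatrixD[OF L] qmatrixD[OF R] that by blast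
  then show ?thesis
    unfolding dcomp_def[of Q \<A> \<C> \<D>] dcomp_def[of Q \<A> \<B> \<D>]
    by (intro restrict_ext) simp
qed

lemma dcomp_dimp_le:
  assumes "qmatrix Q \<A> \<B> \<phi>" "qmatrix Q \<A> \<C> \<eta>"
  shows "matrix_le Q \<A> \<C> (dcomp Q \<A> \<B> \<C> (dimp Q \<A> \<B> \<C> \<eta> \<phi>) \<phi>) \<eta>"
  using le_dimp_iff[OF assms dimp_matrix[OF assms]] matrix_le_refl[OF dimp_matrix[OF assms]]
  by simp

lemma le_dimp_dcomp:
  assumes "qmatrix Q \<A> \<B> \<phi>" "qmatrix Q \<B> \<C> \<psi>"
  shows "matrix_le Q \<B> \<C> \<psi> (dimp Q \<A> \<B> \<C> (dcomp Q \<A> \<B> \<C> \<psi> \<phi>) \<phi>)"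
  using le_dimp_iff[OF assms(1) dcomp_matrix[OF assms] assms(2)]
    matrix_le_refl[OF dcomp_matrix[OF assms]] by simp

lemma dcomp_mono_left:
  assumes \<phi>: "qmatrix Q \<A> \<B> \<phi>" and \<psi>: "qmatrix Q \<B> \<C> \<psi>" and \<psi>': "qmatrix Q \<B> \<C> \<psi>'"
    and le: "matrix_le Q \<B> \<C> \<psi> \<psi>'"
  shows "matrix_le Q \<A> \<C> (dcomp Q \<A> \<B> \<C> \<psi> \<phi>) (dcomp Q \<A> \<B> \<C> \<psi>' \<phi>)"
  using le_dimp_iff[OF \<phi> dcomp_matrix[OF \<phi> \<psi>'] \<psi>]
    matrix_le_trans[OF \<psi> \<psi>' dimp_matrix[OF \<phi> dcomp_matrix[OF \<phi> \<psi>']] le le_dimp_dcomp[OF \<phi> \<psi>']]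
  by blast

lemma dcomp_mono_right:
  assumes \<phi>: "qmatrix Q \<A> \<B> \<phi>" and \<phi>': "qmatrix Q \<A> \<B> \<phi>'" and \<psi>: "qmatrix Q \<B> \<C> \<psi>"
    and le: "matrix_le Q \<A> \<B> \<phi> \<phi>'"
  shows "matrix_le Q \<A> \<C> (dcomp Q \<A> \<B> \<C> \<psi> \<phi>) (dcomp Q \<A> \<B> \<C> \<psi> \<phi>')"
proof -
  note D = qmatrixD[OF \<phi>] qmatrixD[OF \<psi>] qmatrixD(3)[OF \<phi>']
  note \<psi>\<phi>' = dcomp_matrix[OF \<phi>' \<psi>]
  have "qcomp Q (ctype \<A> x) (ctype \<B> y) (ctype \<C> z) (\<psi> y z) (\<phi> x y)
      \<sqsubseteq>\<^bsub>qhom Q (ctype \<A> x) (ctype \<C> z)\<^esub> dcomp Q \<A> \<B> \<C> \<psi> \<phi>' x z"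
    if xyz: "x \<in> carrier \<A>" "y \<in> carrier \<B>" "z \<in> carrier \<C>" for x y z
  proof (rule hom_trans)
    show "qcomp Q (ctype \<A> x) (ctype \<B> y) (ctype \<C> z) (\<psi> y z) (\<phi> x y)
      \<sqsubseteq>\<^bsub>qhom Q (ctype \<A> x) (ctype \<C> z)\<^esub> qcomp Q (ctype \<A> x) (ctype \<B> y) (ctype \<C> z) (\<psi> y z) (\<phi>' x y)"
      by (intro comp_mono_right D matrix_leD[OF le] xyz)
    show "qcomp Q (ctype \<A> x) (ctype \<B> y) (ctype \<C> z) (\<psi> y z) (\<phi>' x y)
      \<sqsubseteq>\<^bsub>qhom Q (ctype \<A> x) (ctype \<C> z)\<^esub> dcomp Q \<A> \<B> \<C> \<psi> \<phi>' x z"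
      using dcomp_le_iff[OF \<phi>' \<psi> \<psi>\<phi>'] matrix_le_refl[OF \<psi>\<phi>'] xyz by blast
  qed (intro comp_closed D qmatrixD(3)[OF \<psi>\<phi>'] xyz)+
  then show ?thesis unfolding dcomp_le_iff[OF \<phi> \<psi> \<psi>\<phi>'] by blast
qed

text \<open>The two distributor laws are inequalities between composite matrices, so that closure
  properties of distributors can be derived without mentioning elements.\<close>

lemma distributor_iff:
  "distributor Q \<A> \<B> \<phi> \<longleftrightarrow> qcategory Q \<A> \<and> qcategory Q \<B> \<and>
    qmatrix Q \<A> \<B> \<phi> \<and> \<phi> \<in> extensional (carrier \<A>) \<and> (\<forall>x\<in>carrier \<A>. \<phi> x \<in> extensional (carrier \<B>)) \<and>
    matrix_le Q \<A> \<B> (dcomp Q \<A> \<B> \<B> (chom \<B>) \<phi>) \<phi> \<and>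
    matrix_le Q \<A> \<B> (dcomp Q \<A> \<A> \<B> \<phi> (chom \<A>)) \<phi>"
proof (cases "qcategory Q \<A> \<and> qcategory Q \<B> \<and> qmatrix Q \<A> \<B> \<phi>")
  case True
  then have "qmatrix Q \<A> \<A> (chom \<A>)" "qmatrix Q \<B> \<B> (chom \<B>)" "qmatrix Q \<A> \<B> \<phi>"
    using qcategory_chom_matrix by auto
  then show ?thesis
    using True dcomp_le_iff[of \<A> \<B> \<phi> \<B> "chom \<B>" \<phi>] dcomp_le_iff[of \<A> \<A> "chom \<A>" \<B> \<phi> \<phi>]
    by (auto simp: distributor_def PiE_iff qmatrixD)
next
  case False
  then show ?thesis using distributorD[of Q \<A> \<B> \<phi>] by blast
qed

text \<open>The codomain of \<open>\<psi> \<circ> \<phi>\<close> acts through \<open>\<psi>\<close> and its domain through \<open>\<phi>\<close>, by associativity.\<close>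

lemma dcomp_distributor:
  assumes \<phi>: "distributor Q \<A> \<B> \<phi>" and \<psi>: "distributor Q \<B> \<C> \<psi>"
  shows "distributor Q \<A> \<C> (dcomp Q \<A> \<B> \<C> \<psi> \<phi>)"
proof -
  note m\<phi> = distributorD(3)[OF \<phi>] and m\<psi> = distributorD(3)[OF \<psi>]
  have mA: "qmatrix Q \<A> \<A> (chom \<A>)" and mC: "qmatrix Q \<C> \<C> (chom \<C>)"
    using qcategory_chom_matrix distributorD[OF \<phi>] distributorD[OF \<psi>] by auto
  have "matrix_le Q \<A> \<C> (dcomp Q \<A> \<C> \<C> (chom \<C>) (dcomp Q \<A> \<B> \<C> \<psi> \<phi>)) (dcomp Q \<A> \<B> \<C> \<psi> \<phi>)"
    unfolding dcomp_assoc[OF m\<phi> m\<psi> mC]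
    using dcomp_mono_left[OF m\<phi> dcomp_matrix[OF m\<psi> mC] m\<psi>] \<psi> by (auto simp: distributor_iff)
  moreover have "matrix_le Q \<A> \<C> (dcomp Q \<A> \<A> \<C> (dcomp Q \<A> \<B> \<C> \<psi> \<phi>) (chom \<A>)) (dcomp Q \<A> \<B> \<C> \<psi> \<phi>)"
    unfolding dcomp_assoc[OF mA m\<phi> m\<psi>, symmetric]
    using dcomp_mono_right[OF dcomp_matrix[OF mA m\<phi>] m\<phi> m\<psi>] \<phi> by (auto simp: distributor_iff)
  ultimately show ?thesis
    using distributorD[OF \<phi>] distributorD[OF \<psi>] dcomp_matrix[OF m\<phi> m\<psi>]
    by (auto simp: distributor_iff) (auto simp: dcomp_def)
qed

text \<open>By residuation it suffices to test the two laws after composing with \<open>\<phi>\<close>. There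
  \<open>\<C> \<circ> (\<eta> \<swarrow> \<phi>) \<circ> \<phi> \<le> \<C> \<circ> \<eta> \<le> \<eta>\<close> and
  \<open>(\<eta> \<swarrow> \<phi>) \<circ> \<B> \<circ> \<phi> \<le> (\<eta> \<swarrow> \<phi>) \<circ> \<phi> \<le> \<eta>\<close>.\<close>

lemma dimp_distributor:
  assumes \<phi>: "distributor Q \<A> \<B> \<phi>" and \<eta>: "distributor Q \<A> \<C> \<eta>"
  shows "distributor Q \<B> \<C> (dimp Q \<A> \<B> \<C> \<eta> \<phi>)" (is "distributor Q \<B> \<C> ?\<delta>")
proof -
  note m\<phi> = distributorD(3)[OF \<phi>] and m\<eta> = distributorD(3)[OF \<eta>]
  have mB: "qmatrix Q \<B> \<B> (chom \<B>)" and mC: "qmatrix Q \<C> \<C> (chom \<C>)"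
    using qcategory_chom_matrix distributorD[OF \<phi>] distributorD[OF \<eta>] by auto
  note m\<delta> = dimp_matrix[OF m\<phi> m\<eta>]
  note \<delta>\<phi> = dcomp_matrix[OF m\<phi> m\<delta>]
  have "matrix_le Q \<A> \<C> (dcomp Q \<A> \<C> \<C> (chom \<C>) (dcomp Q \<A> \<B> \<C> ?\<delta> \<phi>)) \<eta>"
    using \<eta> by (intro matrix_le_trans[OF _ _ _ dcomp_mono_right[OF \<delta>\<phi> m\<eta> mC dcomp_dimp_le[OF m\<phi> m\<eta>]]])
      (auto simp: distributor_iff intro!: dcomp_matrix[OF _ mC] \<delta>\<phi>)
  then have "matrix_le Q \<B> \<C> (dcomp Q \<B> \<C> \<C> (chom \<C>) ?\<delta>) ?\<delta>"
    using le_dimp_iff[OF m\<phi> m\<eta> dcomp_matrix[OF m\<delta> mC]] dcomp_assoc[OF m\<phi> m\<delta> mC] by simp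
  moreover have "matrix_le Q \<A> \<C> (dcomp Q \<A> \<B> \<C> ?\<delta> (dcomp Q \<A> \<B> \<B> (chom \<B>) \<phi>)) \<eta>"
    using \<phi> dcomp_dimp_le[OF m\<phi> m\<eta>]
    by (intro matrix_le_trans[OF _ _ m\<eta> dcomp_mono_right[OF dcomp_matrix[OF m\<phi> mB] m\<phi> m\<delta>]])
      (auto simp: distributor_iff intro!: dcomp_matrix[OF _ m\<delta>] dcomp_matrix[OF m\<phi> mB])
  then have "matrix_le Q \<B> \<C> (dcomp Q \<B> \<B> \<C> ?\<delta> (chom \<B>)) ?\<delta>"
    using le_dimp_iff[OF m\<phi> m\<eta> dcomp_matrix[OF mB m\<delta>]] dcomp_assoc[OF m\<phi> mB m\<delta>] by simp
  ultimately show ?thesis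
    using distributorD[OF \<phi>] distributorD[OF \<eta>] m\<delta>
    by (auto simp: distributor_iff) (auto simp: dimp_def)
qed

section \<open>Presheaves\<close>

lemma star_hom_le_dimp_iff:
  assumes "qmatrix Q \<A> (star Q X) \<mu>" "qmatrix Q \<A> (star Q Y) \<kappa>"
    and "k \<in> carrier (qhom Q X Y)" "X \<in> qob Q" "Y \<in> qob Q"
  shows "k \<sqsubseteq>\<^bsub>qhom Q X Y\<^esub> dimp Q \<A> (star Q X) (star Q Y) \<kappa> \<mu> () () \<longleftrightarrow>
    matrix_le Q \<A> (star Q Y) (dcomp Q \<A> (star Q X) (star Q Y) (\<lambda>_ _. k) \<mu>) \<kappa>"
  using le_dimp_iff[OF assms(1,2), of "\<lambda>_ _. k"] assms(3-)
  by (auto simp: qmatrix_def matrix_le_def)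

lemma matrix_le_star_id_iff:
  assumes \<mu>: "qmatrix Q \<A> (star Q X) \<mu>" and \<kappa>: "qmatrix Q \<A> (star Q X) \<kappa>" and X: "X \<in> qob Q"
  shows "matrix_le Q \<A> (star Q X) (dcomp Q \<A> (star Q X) (star Q X) (\<lambda>_ _. qid Q X) \<mu>) \<kappa>
    \<longleftrightarrow> matrix_le Q \<A> (star Q X) \<mu> \<kappa>"
proof -
  have "qmatrix Q (star Q X) (star Q X) (\<lambda>_ _. qid Q X)"
    using id_closed X by (auto simp: qmatrix_def)
  from dcomp_le_iff[OF \<mu> this \<kappa>] show ?thesis
    using id_left X qmatrixD[OF \<mu>] by (auto simp: matrix_le_def)
qed

text \<open>The underlying preorder of presheaves of one type is the entrywise order: \<open>1 \<le> \<kappa> \<swarrow> \<mu>\<close> means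
  \<open>1 \<circ> \<mu> \<le> \<kappa>\<close>.\<close>

lemma presheaf_under_le_iff:
  assumes "qmatrix Q \<A> (star Q X) \<mu>" "qmatrix Q \<A> (star Q X) \<kappa>" "X \<in> qob Q"
  shows "under_le Q (presheaves Q \<A>) (X, \<mu>) (X, \<kappa>) \<longleftrightarrow> matrix_le Q \<A> (star Q X) \<mu> \<kappa>"
  using star_hom_le_dimp_iff[OF assms(1,2) id_closed] matrix_le_star_id_iff[OF assms] assms(3)
  by (simp add: under_le_def)

text \<open>Composition in the presheaf category is \<open>(\<eta> \<swarrow> \<kappa>) \<circ> (\<kappa> \<swarrow> \<mu>) \<le> \<eta> \<swarrow> \<mu>\<close>, which holds since
  \<open>(\<eta> \<swarrow> \<kappa>) \<circ> (\<kappa> \<swarrow> \<mu>) \<circ> \<mu> \<le> (\<eta> \<swarrow> \<kappa>) \<circ> \<kappa> \<le> \<eta>\<close>.\<close>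

lemma presheaves_qcategory:
  "qcategory Q (presheaves Q \<A>)"
proof -
  have hom: "dimp Q \<A> (star Q X) (star Q Y) \<kappa> \<mu> () () \<in> carrier (qhom Q X Y)"
    if "distributor Q \<A> (star Q X) \<mu>" "distributor Q \<A> (star Q Y) \<kappa>" for X Y \<mu> \<kappa>
    using qmatrixD(3)[OF dimp_matrix[OF that[THEN distributorD(3)]]] by simp
  have unit: "qid Q X \<sqsubseteq>\<^bsub>qhom Q X X\<^esub> dimp Q \<A> (star Q X) (star Q X) \<mu> \<mu> () ()"
    if "X \<in> qob Q" "distributor Q \<A> (star Q X) \<mu>" for X \<mu>
    using presheaf_under_le_iff[OF distributorD(3)[OF that(2)] distributorD(3)[OF that(2)] that(1)]
      matrix_le_refl[OF distributorD(3)[OF that(2)]]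
    by (simp add: under_le_def)
  have mult: "qcomp Q X Y Z (dimp Q \<A> (star Q Y) (star Q Z) \<eta> \<kappa> () ())
      (dimp Q \<A> (star Q X) (star Q Y) \<kappa> \<mu> () ())
      \<sqsubseteq>\<^bsub>qhom Q X Z\<^esub> dimp Q \<A> (star Q X) (star Q Z) \<eta> \<mu> () ()"
    if ob: "X \<in> qob Q" "Y \<in> qob Q" "Z \<in> qob Q" and d: "distributor Q \<A> (star Q X) \<mu>"
      "distributor Q \<A> (star Q Y) \<kappa>" "distributor Q \<A> (star Q Z) \<eta>" for X Y Z \<mu> \<kappa> \<eta>
  proof -
    note m = d[THEN distributorD(3)]
    note k = dimp_matrix[OF m(1,2)] and l = dimp_matrix[OF m(2,3)] and n = dimp_matrix[OF m(1,3)]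
    note lk = dcomp_matrix[OF k l]
    let ?k = "dimp Q \<A> (star Q X) (star Q Y) \<kappa> \<mu>" and ?l = "dimp Q \<A> (star Q Y) (star Q Z) \<eta> \<kappa>"
    have "matrix_le Q \<A> (star Q Z) (dcomp Q \<A> (star Q Y) (star Q Z) ?l (dcomp Q \<A> (star Q X) (star Q Y) ?k \<mu>)) \<eta>"
      by (rule matrix_le_trans[OF _ _ _ dcomp_mono_right[OF _ _ l dcomp_dimp_le[OF m(1,2)]]
            dcomp_dimp_le[OF m(2,3)]]) (intro dcomp_matrix m k l)+
    then have "matrix_le Q (star Q X) (star Q Z) (dcomp Q (star Q X) (star Q Y) (star Q Z) ?l ?k)
        (dimp Q \<A> (star Q X) (star Q Z) \<eta> \<mu>)"
      using le_dimp_iff[OF m(1,3) lk] dcomp_assoc[OF m(1) k l] by simp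
    then show ?thesis using dcomp_le_iff[OF k l n] by simp
  qed
  show ?thesis unfolding qcategory_def
    using hom unit mult by (auto simp: split_paired_all)
qed

text \<open>A map of presheaves is functorial as soon as \<open>k \<circ> \<mu> \<le> \<kappa>\<close> implies \<open>k \<circ> T \<mu> \<le> T \<kappa>\<close> for
  all arrows \<open>k\<close> between the types: the case \<open>k = \<kappa> \<swarrow> \<mu>\<close> is the inequality between
  the hom-arrows.\<close>

lemma presheaf_qfunctorI:
  assumes dist: "\<And>X \<mu>. X \<in> qob Q \<Longrightarrow> distributor Q \<A> (star Q X) \<mu> \<Longrightarrow> distributor Q \<B> (star Q X) (T X \<mu>)"
    and act: "\<And>X Y \<mu> \<kappa> k. \<lbrakk>X \<in> qob Q; Y \<in> qob Q;
        distributor Q \<A> (star Q X) \<mu>; distributor Q \<A> (star Q Y) \<kappa>; qmatrix Q (star Q X) (star Q Y) k;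
        matrix_le Q \<A> (star Q Y) (dcomp Q \<A> (star Q X) (star Q Y) k \<mu>) \<kappa>\<rbrakk>
      \<Longrightarrow> matrix_le Q \<B> (star Q Y) (dcomp Q \<B> (star Q X) (star Q Y) k (T X \<mu>)) (T Y \<kappa>)"
  shows "qfunctor Q (presheaves Q \<A>) (presheaves Q \<B>) (\<lambda>(X, \<mu>). (X, T X \<mu>))"
proof -
  have "dimp Q \<A> (star Q X) (star Q Y) \<kappa> \<mu> () ()
      \<sqsubseteq>\<^bsub>qhom Q X Y\<^esub> dimp Q \<B> (star Q X) (star Q Y) (T Y \<kappa>) (T X \<mu>) () ()"
    if *: "X \<in> qob Q" "Y \<in> qob Q" "distributor Q \<A> (star Q X) \<mu>" "distributor Q \<A> (star Q Y) \<kappa>"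
    for X Y \<mu> \<kappa>
  proof -
    note m = *(3,4)[THEN distributorD(3)]
    note mT = dist[OF *(1,3), THEN distributorD(3)] dist[OF *(2,4), THEN distributorD(3)]
    show ?thesis
      using le_dimp_iff[OF mT dimp_matrix[OF m]] act[OF * dimp_matrix[OF m] dcomp_dimp_le[OF m]]
      by (auto simp: matrix_le_def)
  qed
  then show ?thesis
    using dist by (auto simp: qfunctor_def split_paired_all presheaves_qcategory)
qed

text \<open>If \<open>k \<circ> \<mu> \<le> \<kappa>\<close> then \<open>k \<circ> (\<mu> \<circ> \<phi>) = (k \<circ> \<mu>) \<circ> \<phi> \<le> \<kappa> \<circ> \<phi>\<close>.\<close>

lemma upper_star_qfunctor:
  assumes \<phi>: "distributor Q \<A> \<B> \<phi>"
  shows "qfunctor Q (presheaves Q \<B>) (presheaves Q \<A>) (upper_star Q \<A> \<B> \<phi>)"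
  unfolding upper_star_def
proof (rule presheaf_qfunctorI)
  note m\<phi> = distributorD(3)[OF \<phi>]
  fix X Y \<mu> \<kappa> k
  assume \<mu>: "distributor Q \<B> (star Q X) \<mu>" and \<kappa>: "distributor Q \<B> (star Q Y) \<kappa>"
    and k: "qmatrix Q (star Q X) (star Q Y) k"
    and le: "matrix_le Q \<B> (star Q Y) (dcomp Q \<B> (star Q X) (star Q Y) k \<mu>) \<kappa>"
  note m = \<mu>[THEN distributorD(3)] \<kappa>[THEN distributorD(3)]
  show "matrix_le Q \<A> (star Q Y)
      (dcomp Q \<A> (star Q X) (star Q Y) k (dcomp Q \<A> \<B> (star Q X) \<mu> \<phi>)) (dcomp Q \<A> \<B> (star Q Y) \<kappa> \<phi>)"
    unfolding dcomp_assoc[OF m\<phi> m(1) k]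
    by (rule dcomp_mono_left[OF m\<phi> dcomp_matrix[OF m(1) k] m(2) le])
qed (rule dcomp_distributor[OF \<phi>])

text \<open>If \<open>k \<circ> \<mu> \<le> \<kappa>\<close> then \<open>k \<circ> (\<mu> \<swarrow> \<phi>) \<circ> \<phi> \<le> k \<circ> \<mu> \<le> \<kappa>\<close>, and residuation moves the last
  \<open>\<phi>\<close> to the right.\<close>

lemma lower_star_qfunctor:
  assumes \<phi>: "distributor Q \<A> \<B> \<phi>"
  shows "qfunctor Q (presheaves Q \<A>) (presheaves Q \<B>) (lower_star Q \<A> \<B> \<phi>)"
  unfolding lower_star_def
proof (rule presheaf_qfunctorI)
  note m\<phi> = distributorD(3)[OF \<phi>]
  fix X Y \<mu> \<kappa> k
  assume \<mu>: "distributor Q \<A> (star Q X) \<mu>" and \<kappa>: "distributor Q \<A> (star Q Y) \<kappa>"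
    and k: "qmatrix Q (star Q X) (star Q Y) k"
    and le: "matrix_le Q \<A> (star Q Y) (dcomp Q \<A> (star Q X) (star Q Y) k \<mu>) \<kappa>"
  note m = \<mu>[THEN distributorD(3)] \<kappa>[THEN distributorD(3)]
  note \<delta> = dimp_matrix[OF m\<phi> m(1)]
  have "matrix_le Q \<A> (star Q Y)
      (dcomp Q \<A> (star Q X) (star Q Y) k (dcomp Q \<A> \<B> (star Q X) (dimp Q \<A> \<B> (star Q X) \<mu> \<phi>) \<phi>)) \<kappa>"
    by (rule matrix_le_trans[OF _ _ m(2) dcomp_mono_right[OF _ m(1) k dcomp_dimp_le[OF m\<phi> m(1)]] le])
      (intro dcomp_matrix m m\<phi> \<delta> k)+
  then show "matrix_le Q \<B> (star Q Y)
      (dcomp Q \<B> (star Q X) (star Q Y) k (dimp Q \<A> \<B> (star Q X) \<mu> \<phi>)) (dimp Q \<A> \<B> (star Q Y) \<kappa> \<phi>)"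
    using le_dimp_iff[OF m\<phi> m(2) dcomp_matrix[OF \<delta> k]] dcomp_assoc[OF m\<phi> \<delta> k] by simp
qed (rule dimp_distributor[OF \<phi>])

lemma qfunctor_comp:
  assumes "qfunctor Q \<A> \<B> F" "qfunctor Q \<B> \<C> G"
  shows "qfunctor Q \<A> \<C> (G \<circ> F)"
proof -
  note F = assms(1)[unfolded qfunctor_def] and G = assms(2)[unfolded qfunctor_def]
  have "chom \<A> x x' \<sqsubseteq>\<^bsub>qhom Q (ctype \<A> x) (ctype \<A> x')\<^esub> chom \<C> (G (F x)) (G (F x'))"
    if x: "x \<in> carrier \<A>" "x' \<in> carrier \<A>" for x x'
  proof (rule hom_trans)
    have Fx: "F x \<in> carrier \<B>" "F x' \<in> carrier \<B>" "ctype \<B> (F x) = ctype \<A> x" "ctype \<B> (F x') = ctype \<A> x'"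
      using F x by auto
    moreover have GFx: "G (F x) \<in> carrier \<C>" "G (F x') \<in> carrier \<C>"
      "ctype \<C> (G (F x)) = ctype \<A> x" "ctype \<C> (G (F x')) = ctype \<A> x'"
      using G Fx by auto
    ultimately show "ctype \<A> x \<in> qob Q" "ctype \<A> x' \<in> qob Q"
      "chom \<A> x x' \<in> carrier (qhom Q (ctype \<A> x) (ctype \<A> x'))"
      "chom \<B> (F x) (F x') \<in> carrier (qhom Q (ctype \<A> x) (ctype \<A> x'))"
      "chom \<C> (G (F x)) (G (F x')) \<in> carrier (qhom Q (ctype \<A> x) (ctype \<A> x'))"
      using F G x unfolding qcategory_def by metis+
    show "chom \<A> x x' \<sqsubseteq>\<^bsub>qhom Q (ctype \<A> x) (ctype \<A> x')\<^esub> chom \<B> (F x) (F x')"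
      using F x by blast
    show "chom \<B> (F x) (F x') \<sqsubseteq>\<^bsub>qhom Q (ctype \<A> x) (ctype \<A> x')\<^esub> chom \<C> (G (F x)) (G (F x'))"
      using G Fx by metis
  qed
  then show ?thesis using F G by (simp add: qfunctor_def Pi_iff)
qed

section \<open>Closure operators and continuity\<close>

text \<open>The closure operator of the Kan adjunction between \<open>\<phi>\<^sup>*\<close> and \<open>\<phi>\<^sub>*\<close>. It is extensive by the unit;
  the inequality \<open>c (c \<kappa>) \<le> c \<kappa>\<close> becomes, by residuation, two applications of the counit.\<close>

lemma kan_closure_operator:
  assumes \<phi>: "distributor Q \<A> \<B> \<phi>"
  shows "closure_operator Q (presheaves Q \<B>) (lower_star Q \<A> \<B> \<phi> \<circ> upper_star Q \<A> \<B> \<phi>)"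
    (is "closure_operator Q _ ?c")
proof -
  note m\<phi> = distributorD(3)[OF \<phi>]
  have extensive: "under_le Q (presheaves Q \<B>) (X, \<kappa>) (?c (X, \<kappa>))"
    if X: "X \<in> qob Q" and \<kappa>: "qmatrix Q \<B> (star Q X) \<kappa>" for X \<kappa>
    using presheaf_under_le_iff[OF \<kappa> dimp_matrix[OF m\<phi> dcomp_matrix[OF m\<phi> \<kappa>]] X]
      le_dimp_dcomp[OF m\<phi> \<kappa>] by (simp add: upper_star_def lower_star_def)
  have idem: "under_le Q (presheaves Q \<B>) (?c (?c (X, \<kappa>))) (?c (X, \<kappa>))"
    if X: "X \<in> qob Q" and \<kappa>: "qmatrix Q \<B> (star Q X) \<kappa>" for X \<kappa>
  proof -
    let ?i = "\<lambda>\<mu>. dimp Q \<A> \<B> (star Q X) \<mu> \<phi>" and ?d = "\<lambda>\<kappa>. dcomp Q \<A> \<B> (star Q X) \<kappa> \<phi>"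
    note d = dcomp_matrix[OF m\<phi>] and i = dimp_matrix[OF m\<phi>]
    have "matrix_le Q \<A> (star Q X) (?d (?i (?d (?i (?d \<kappa>))))) (?d \<kappa>)"
      by (rule matrix_le_trans[OF _ _ _ dcomp_dimp_le[OF m\<phi>] dcomp_dimp_le[OF m\<phi>]]) (intro d i \<kappa>)+
    then show ?thesis
      by (simp add: upper_star_def lower_star_def presheaf_under_le_iff[OF _ _ X]
          le_dimp_iff[OF m\<phi>] d i \<kappa>)
  qed
  have c_matrix: "\<exists>\<eta>. ?c (X, \<kappa>) = (X, \<eta>) \<and> qmatrix Q \<B> (star Q X) \<eta>" if "qmatrix Q \<B> (star Q X) \<kappa>" for X \<kappa>
    using dimp_matrix[OF m\<phi> dcomp_matrix[OF m\<phi> that]] by (simp add: upper_star_def lower_star_def)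
  have "functor_le Q (presheaves Q \<B>) (presheaves Q \<B>) id ?c"
    by (auto simp: functor_le_def simp del: comp_apply intro!: extensive distributorD(3))
  moreover have "under_iso Q (presheaves Q \<B>) (?c (?c (X, \<kappa>))) (?c (X, \<kappa>))"
    if X: "X \<in> qob Q" and \<kappa>: "qmatrix Q \<B> (star Q X) \<kappa>" for X \<kappa>
    using idem[OF that] c_matrix[OF \<kappa>] extensive[OF X] unfolding under_iso_def by auto
  then have "functor_iso Q (presheaves Q \<B>) (presheaves Q \<B>) (?c \<circ> ?c) ?c"
    by (auto simp: functor_iso_def split_paired_all distributorD(3))
  ultimately show ?thesis
    using qfunctor_comp[OF upper_star_qfunctor[OF \<phi>] lower_star_qfunctor[OF \<phi>]]
    by (simp add: closure_operator_def)
qed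

lemma graph_matrices:
  assumes "qfunctor Q \<A> \<B> F"
  shows fgraph_matrix: "qmatrix Q \<A> \<B> (fgraph \<A> \<B> F)"
    and fcograph_matrix: "qmatrix Q \<B> \<A> (fcograph \<A> \<B> F)"
proof -
  have "ctype \<A> x \<in> qob Q" "F x \<in> carrier \<B>" "ctype \<B> (F x) = ctype \<A> x" if "x \<in> carrier \<A>" for x
    using assms that by (auto simp: qfunctor_def qcategory_def)
  moreover note qcategory_chom_matrix[of Q \<B>]
  ultimately show "qmatrix Q \<A> \<B> (fgraph \<A> \<B> F)" "qmatrix Q \<B> \<A> (fcograph \<A> \<B> F)"
    using assms by (auto simp: fgraph_def fcograph_def qmatrix_def qfunctor_def) metis+
qed

text \<open>The inequality of continuity, with any codomain \<open>\<S>\<close> in place of the one-object categories of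
  presheaves. After residuation along \<open>\<phi>\<close> it is the counit for \<open>\<psi>\<close> composed with \<open>F\<^sub>\<natural>\<close>.\<close>

lemma infomorphism_closure_le:
  assumes inf: "infomorphism Q \<A> \<B> \<phi> \<A>' \<B>' \<psi> F G"
    and \<kappa>: "qmatrix Q \<B>' \<S> \<kappa>"
  shows "matrix_le Q \<B> \<S>
    (dcomp Q \<B> \<B>' \<S> (dimp Q \<A>' \<B>' \<S> (dcomp Q \<A>' \<B>' \<S> \<kappa> \<psi>) \<psi>) (fcograph \<B>' \<B> G))
    (dimp Q \<A> \<B> \<S> (dcomp Q \<A> \<B> \<S> (dcomp Q \<B> \<B>' \<S> \<kappa> (fcograph \<B>' \<B> G)) \<phi>) \<phi>)"
    (is "matrix_le Q \<B> \<S> (dcomp Q \<B> \<B>' \<S> ?\<delta> ?G) _")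
proof -
  let ?F = "fgraph \<A> \<A>' F"
  have \<phi>: "qmatrix Q \<A> \<B> \<phi>" and \<psi>: "qmatrix Q \<A>' \<B>' \<psi>"
    and F: "qmatrix Q \<A> \<A>' ?F" and G: "qmatrix Q \<B> \<B>' ?G"
    and eq: "dcomp Q \<A> \<B> \<B>' ?G \<phi> = dcomp Q \<A> \<A>' \<B>' \<psi> ?F"
    using inf by (auto simp: infomorphism_def intro: distributorD(3) fgraph_matrix fcograph_matrix)
  note \<kappa>\<psi> = dcomp_matrix[OF \<psi> \<kappa>]
  note \<delta> = dimp_matrix[OF \<psi> \<kappa>\<psi>]
  \<comment> \<open>Moving from \<open>\<B>'\<close> to \<open>\<A>\<close> along \<open>\<B>\<close> or along \<open>\<A>'\<close> gives the same matrix, by the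
     infomorphism equation.\<close>
  have transport: "dcomp Q \<A> \<B> \<S> (dcomp Q \<B> \<B>' \<S> \<eta> ?G) \<phi> = dcomp Q \<A> \<A>' \<S> (dcomp Q \<A>' \<B>' \<S> \<eta> \<psi>) ?F"
    if "qmatrix Q \<B>' \<S> \<eta>" for \<eta>
    using dcomp_assoc[OF \<phi> G that] dcomp_assoc[OF F \<psi> that] eq by simp
  have "matrix_le Q \<A> \<S> (dcomp Q \<A> \<B> \<S> (dcomp Q \<B> \<B>' \<S> ?\<delta> ?G) \<phi>)
      (dcomp Q \<A> \<B> \<S> (dcomp Q \<B> \<B>' \<S> \<kappa> ?G) \<phi>)"
    unfolding transport[OF \<delta>] transport[OF \<kappa>]
    by (rule dcomp_mono_left[OF F dcomp_matrix[OF \<psi> \<delta>] \<kappa>\<psi> dcomp_dimp_le[OF \<psi> \<kappa>\<psi>]])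
  then show ?thesis
    using le_dimp_iff[OF \<phi> dcomp_matrix[OF \<phi> dcomp_matrix[OF G \<kappa>]] dcomp_matrix[OF G \<delta>]] by simp
qed

lemma infomorphism_continuous:
  assumes inf: "infomorphism Q \<A> \<B> \<phi> \<A>' \<B>' \<psi> F G"
  shows "continuous_qfunctor Q
    (\<B>', lower_star Q \<A>' \<B>' \<psi> \<circ> upper_star Q \<A>' \<B>' \<psi>)
    (\<B>, lower_star Q \<A> \<B> \<phi> \<circ> upper_star Q \<A> \<B> \<phi>) G"
proof -
  have \<phi>: "distributor Q \<A> \<B> \<phi>" and \<psi>: "distributor Q \<A>' \<B>' \<psi>" and G: "qfunctor Q \<B>' \<B> G"
    using inf by (auto simp: infomorphism_def)
  note m\<phi> = distributorD(3)[OF \<phi>] and m\<psi> = distributorD(3)[OF \<psi>] and mG = fcograph_matrix[OF G]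
  have "functor_le Q (presheaves Q \<B>') (presheaves Q \<B>)
      (direct_image Q \<B>' \<B> G \<circ> (lower_star Q \<A>' \<B>' \<psi> \<circ> upper_star Q \<A>' \<B>' \<psi>))
      (lower_star Q \<A> \<B> \<phi> \<circ> upper_star Q \<A> \<B> \<phi> \<circ> direct_image Q \<B>' \<B> G)"
    unfolding functor_le_def
  proof (clarify, simp only: presheaves_simps, elim conjE)
    fix X \<kappa> assume X: "X \<in> qob Q" and \<kappa>: "distributor Q \<B>' (star Q X) \<kappa>"
    note m\<kappa> = distributorD(3)[OF \<kappa>]
    show "under_le Q (presheaves Q \<B>)
      ((direct_image Q \<B>' \<B> G \<circ> (lower_star Q \<A>' \<B>' \<psi> \<circ> upper_star Q \<A>' \<B>' \<psi>)) (X, \<kappa>))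
      ((lower_star Q \<A> \<B> \<phi> \<circ> upper_star Q \<A> \<B> \<phi> \<circ> direct_image Q \<B>' \<B> G) (X, \<kappa>))"
      using infomorphism_closure_le[OF inf m\<kappa>]
        presheaf_under_le_iff[OF dcomp_matrix[OF mG dimp_matrix[OF m\<psi> dcomp_matrix[OF m\<psi> m\<kappa>]]]
          dimp_matrix[OF m\<phi> dcomp_matrix[OF m\<phi> dcomp_matrix[OF mG m\<kappa>]]] X]
      by (simp add: direct_image_def lower_star_def upper_star_def)
  qed
  then show ?thesis
    using kan_closure_operator[OF \<phi>] kan_closure_operator[OF \<psi>] G
      distributorD[OF \<phi>] distributorD[OF \<psi>]
    by (simp add: continuous_qfunctor_def closure_space_def)
qed

end

theorem proposition5p8:
  fixes Q :: "('o, 'm) quantaloid"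
    and \<A> :: "('a, 'o, 'm) qcat" and \<B> :: "('b, 'o, 'm) qcat" and \<phi> :: "'a \<Rightarrow> 'b \<Rightarrow> 'm"
    and \<A>' :: "('c, 'o, 'm) qcat" and \<B>' :: "('d, 'o, 'm) qcat" and \<psi> :: "'c \<Rightarrow> 'd \<Rightarrow> 'm"
    and F :: "'a \<Rightarrow> 'c" and G :: "'d \<Rightarrow> 'b"
  assumes "quantaloid Q"
    and "infomorphism Q \<A> \<B> \<phi> \<A>' \<B>' \<psi> F G"
  shows "continuous_qfunctor Q
    (\<B>', lower_star Q \<A>' \<B>' \<psi> \<circ> upper_star Q \<A>' \<B>' \<psi>)
    (\<B>, lower_star Q \<A> \<B> \<phi> \<circ> upper_star Q \<A> \<B> \<phi>) G"
  using assms by (rule quantaloid.infomorphism_continuous)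

end
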